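(* For $\mu\in\mathbb{C}$, $k\in\mathbb{N}_0$ and real $x\notin\{0,1,-1\}$, the following (mutually inverse) finite sums hold: $$\frac{(2k)!\,C_{2k}^{\mu+1/2}(x)}{2^{2k}k!\,(1-x^2)^k}=\sum_{r=0}^{k}\frac{(-2k-\mu)_{k-r}\left(\mu+\frac12\right)_{k-r}}{(k-r)!}\;\frac{(2r)!\,C_{2r}^{\mu+k-r+1/2}\left(\frac1x\right)}{2^{2r}r!\,(1/x^2-1)^r},$$ $$\frac{(2k)!\,C_{2k}^{\mu+1/2}\left(\frac1x\right)}{2^{2k}k!\,(1-1/x^2)^k}=\sum_{r=0}^{k}\frac{(-2k-\mu)_{k-r}\left(\mu+\frac12\right)_{k-r}}{(k-r)!}\;\frac{(2r)!\,C_{2r}^{\mu+k-r+1/2}(x)}{2^{2r}r!\,(x^2-1)^r}.$$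
   Context: $\mathbb{N}_0=\{0,1,2,\dots\}$; $(a)_n=a(a+1)\cdots(a+n-1)$, $(a)_0=1$. $C_k^{\lambda}(x)=\sum_{j=0}^{[k/2]}\frac{(-1)^j(\lambda)_{k-j}}{j!\,(k-2j)!}(2x)^{k-2j}$ is the Gegenbauer polynomial, for any $\lambda\in\mathbb{C}$. *)

theory Defs
  imports Complex_Main
begin

text \<open>Gegenbauer polynomials with an arbitrary complex parameter \<open>l\<close>, given by the explicit
  sum, so that no value of \<open>l\<close> is exceptional.\<close>

definition gegenbauer :: "nat \<Rightarrow> complex \<Rightarrow> complex \<Rightarrow> complex" where
  "gegenbauer k l x =
     (\<Sum>j\<le>k div 2. (-1) ^ j * pochhammer l (k - j) / (fact j * fact (k - 2 * j))
                    * (2 * x) ^ (k - 2 * j))"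

definition sum_coeff :: "complex \<Rightarrow> nat \<Rightarrow> nat \<Rightarrow> complex" where
  "sum_coeff \<mu> k r =
     pochhammer (- 2 * of_nat k - \<mu>) (k - r) * pochhammer (\<mu> + 1/2) (k - r) / fact (k - r)"

text \<open>The sums to be inverted express a family \<open>a \<mu> k\<close> through a family \<open>b\<close> whose parameter
  is shifted from \<open>\<mu>\<close> to \<open>\<mu> + k - r\<close>. Two such transformations, with coefficients \<open>c\<close>
  and \<open>d\<close>, are inverse to each other if for arbitrary families one holds exactly when the
  other does.\<close>

definition inverse_sums ::
  "(complex \<Rightarrow> nat \<Rightarrow> nat \<Rightarrow> complex) \<Rightarrow> (complex \<Rightarrow> nat \<Rightarrow> nat \<Rightarrow> complex) \<Rightarrow> bool" where
  "inverse_sums c d \<longleftrightarrow>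
     (\<forall>a b :: complex \<Rightarrow> nat \<Rightarrow> complex.
        (\<forall>\<mu> k. a \<mu> k = (\<Sum>r\<le>k. c \<mu> k r * b (\<mu> + of_nat k - of_nat r) r)) \<longleftrightarrow>
        (\<forall>\<mu> k. b \<mu> k = (\<Sum>r\<le>k. d \<mu> k r * a (\<mu> + of_nat k - of_nat r) r)))"

text \<open>Write \<open>a \<mu> k\<close> for the left-hand side of the first Gegenbauer sum and
  \<open>b \<mu> r\<close> for \<open>(2r)! C_2r (1/x) / (2^(2r) r! (1/x^2 - 1)^r)\<close> with parameter \<open>\<mu> + 1/2\<close>, as on
  its right-hand side. The second sum has denominators \<open>(1 - 1/x^2)^k\<close> and \<open>(x^2 - 1)^r\<close>, so
  it relates \<open>(-1)^k b\<close> to \<open>(-1)^r a\<close>. Hence the coefficients of the inverse pair are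
  \<open>sum_coeff \<mu> k r\<close> and \<open>(-1)^(k + r) * sum_coeff \<mu> k r\<close>.\<close>

end

theory Submission
  imports Defs
begin

text \<open>
  Put \<open>\<lambda> = \<mu> + 1/2\<close>. By the duplication formula \<open>(2k)! = 4\<^sup>k (1/2)\<^sub>k k!\<close>, the normalised
  even Gegenbauer polynomial \<open>(2k)! C\<^sub>2\<^sub>k\<^sup>\<lambda>(x) / (4\<^sup>k k!)\<close> is a polynomial \<open>G\<^sub>k\<^sup>\<lambda>\<close> in
  \<open>y = x\<^sup>2\<close> (lemma \<open>gegenbauer_even\<close>). The first sum, multiplied by \<open>(1 - y)\<^sup>k\<close>, becomes
  the polynomial identity
  \<open>G\<^sub>k\<^sup>\<lambda>(y) = \<Sum>\<^sub>r (a)\<^sub>k\<^sub>-\<^sub>r (\<lambda>)\<^sub>k\<^sub>-\<^sub>r / (k-r)! (1-y)\<^sup>k\<^sup>-\<^sup>r y\<^sup>r G\<^sub>r(1/y)\<close> with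
  \<open>a = 1/2 - 2k - \<lambda>\<close>, where the \<open>G\<^sub>r\<close> on the right has parameter \<open>\<lambda> + k - r\<close>.

  The shift of the parameter is what makes this tractable: \<open>(\<lambda>)\<^sub>k\<^sub>-\<^sub>r\<close> and the factor
  \<open>(\<lambda>+k-r)\<^sub>r\<^sub>+\<^sub>m\<close> from the \<open>m\<close>-th term of \<open>G\<^sub>r\<close> combine to \<open>(\<lambda>)\<^sub>k\<^sub>+\<^sub>m\<close>, which does not depend
  on \<open>r\<close>. For fixed \<open>m\<close> the sum over \<open>r\<close> is then a convolution of two binomial series, one
  in \<open>1 - y\<close> and one in \<open>-y\<close>; expanding the powers of \<open>1 - y\<close> and applying the
  Chu-Vandermonde identity turns it into a sum over powers of \<open>y\<close> alone
  (\<open>pochhammer_convolution_rebase\<close>). In the coefficient of \<open>y\<^sup>p\<close>, the Pochhammer symbol so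
  created has a base that no longer depends on \<open>m\<close>, and the remaining sum over \<open>m\<close> is a
  second instance of Chu-Vandermonde. This proves \<open>even_gegenbauer_reciprocal\<close>. The second
  sum is the first one at \<open>1/x\<close>.

  For the inverse pair, the same merging of Pochhammer symbols shows that composing two
  coefficients, \<open>k\<close> to \<open>r\<close> and then \<open>r\<close> to \<open>s\<close>, gives the coefficient from \<open>k\<close> to \<open>s\<close>
  times a binomial coefficient (\<open>sum_coeff_compose\<close>), so that the transformation with
  alternating signs is inverse to the original one because
  \<open>\<Sum>\<^sub>i (-1)\<^sup>i (n choose i)\<close> vanishes for \<open>n > 0\<close>.
\<close>

section \<open>Convolutions of Pochhammer symbols\<close>

lemma sum_triangle_reindex_diff:
  fixes f :: "nat \<Rightarrow> nat \<Rightarrow> 'a::comm_monoid_add"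
  shows "(\<Sum>r\<le>n. \<Sum>m\<le>r. f r m) = (\<Sum>m\<le>n. \<Sum>s\<le>n-m. f (m + s) m)"
  unfolding sum.Sigma[OF finite_atMost, OF ballI, OF finite_atMost]
  by (rule sum.reindex_bij_witness[where i = "\<lambda>(m, s). (m + s, m)" and j = "\<lambda>(r, m). (m, r - m)"]) auto

lemma sum_triangle_swap:
  fixes f :: "nat \<Rightarrow> nat \<Rightarrow> 'a::comm_monoid_add"
  shows "(\<Sum>i\<le>n. \<Sum>j\<le>n-i. f i j) = (\<Sum>j\<le>n. \<Sum>i\<le>n-j. f i j)"
  unfolding sum.Sigma[OF finite_atMost, OF ballI, OF finite_atMost]
  by (rule sum.reindex_bij_witness[where i = "\<lambda>(j, i). (i, j)" and j = "\<lambda>(i, j). (j, i)"]) auto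

text \<open>The Chu-Vandermonde identity for the divided symbols \<open>(a)\<^sub>n / n!\<close>, which are the
  coefficients of \<open>(1 - t)\<close> to the power \<open>-a\<close>.\<close>

lemma pochhammer_vandermonde:
  fixes a b :: "'a::field_char_0"
  shows "(\<Sum>s\<le>n. pochhammer a (n - s) / fact (n - s) * (pochhammer b s / fact s))
           = pochhammer (a + b) n / fact n"
proof -
  have "pochhammer (b + a) n / fact n
      = (\<Sum>s\<le>n. of_nat (n choose s) * pochhammer b s * pochhammer a (n - s) / fact n)"
    by (simp add: pochhammer_binomial_sum sum_divide_distrib)
  also have "\<dots> = (\<Sum>s\<le>n. pochhammer a (n - s) / fact (n - s) * (pochhammer b s / fact s))"
    by (intro sum.cong refl) (simp add: binomial_fact mult.commute)
  finally show ?thesis by (simp add: add.commute)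
qed

text \<open>Both sides are the coefficient of \<open>t\<^sup>n\<close> in the product of the powers
  \<open>(1 - (u+v)t)\<^sup>-\<^sup>a\<close> and \<open>(1 - vt)\<^sup>-\<^sup>b\<close>; the right-hand side comes from writing
  \<open>1 - (u+v)t\<close> as \<open>(1 - vt) (1 - ut/(1 - vt))\<close>. The finite proof expands \<open>(u+v)\<^sup>n\<^sup>-\<^sup>s\<close> and sums
  over \<open>s\<close> by Chu-Vandermonde.\<close>

lemma pochhammer_convolution_rebase:
  fixes a b u v :: "'a::field_char_0"
  shows "(\<Sum>s\<le>n. pochhammer a (n - s) / fact (n - s) * (u + v) ^ (n - s)
                    * (pochhammer b s / fact s * v ^ s))
       = (\<Sum>i\<le>n. pochhammer a i / fact i * u ^ i
                    * (pochhammer (a + b + of_nat i) (n - i) / fact (n - i) * v ^ (n - i)))"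
proof -
  have "(\<Sum>s\<le>n. pochhammer a (n - s) / fact (n - s) * (u + v) ^ (n - s)
                    * (pochhammer b s / fact s * v ^ s))
      = (\<Sum>s\<le>n. \<Sum>i\<le>n-s. pochhammer a i / fact i * u ^ i * v ^ (n - i)
            * (pochhammer (a + of_nat i) (n - i - s) / fact (n - i - s) * (pochhammer b s / fact s)))"
  proof (intro sum.cong refl)
    fix s assume "s \<in> {..n}"
    hence s: "s \<le> n" by simp
    have "pochhammer a (n - s) / fact (n - s) * (u + v) ^ (n - s) * (pochhammer b s / fact s * v ^ s)
        = (\<Sum>i\<le>n-s. pochhammer a (n - s) / fact (n - s)
             * (of_nat (n - s choose i) * u ^ i * v ^ (n - s - i)) * (pochhammer b s / fact s * v ^ s))"
      by (simp only: binomial_ring sum_distrib_left sum_distrib_right)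
    also have "\<dots> = (\<Sum>i\<le>n-s. pochhammer a i / fact i * u ^ i * v ^ (n - i)
            * (pochhammer (a + of_nat i) (n - i - s) / fact (n - i - s) * (pochhammer b s / fact s)))"
    proof (intro sum.cong refl)
      fix i assume "i \<in> {..n-s}"
      hence i: "i \<le> n - s" by simp
      have 1: "pochhammer a (n - s) = pochhammer a i * pochhammer (a + of_nat i) (n - s - i)"
        using i by (rule pochhammer_product)
      have 2: "n - i = (n - s - i) + s" and 3: "n - i - s = n - s - i" using i s by auto
      show "pochhammer a (n - s) / fact (n - s)
             * (of_nat (n - s choose i) * u ^ i * v ^ (n - s - i)) * (pochhammer b s / fact s * v ^ s)
          = pochhammer a i / fact i * u ^ i * v ^ (n - i)
            * (pochhammer (a + of_nat i) (n - i - s) / fact (n - i - s) * (pochhammer b s / fact s))"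
        unfolding 3 unfolding 2 power_add 1 binomial_fact[OF i] by (simp add: mult_ac)
    qed
    finally show "pochhammer a (n - s) / fact (n - s) * (u + v) ^ (n - s)
                    * (pochhammer b s / fact s * v ^ s)
      = (\<Sum>i\<le>n-s. pochhammer a i / fact i * u ^ i * v ^ (n - i)
            * (pochhammer (a + of_nat i) (n - i - s) / fact (n - i - s) * (pochhammer b s / fact s)))" .
  qed
  also have "\<dots> = (\<Sum>i\<le>n. pochhammer a i / fact i * u ^ i * v ^ (n - i)
      * (\<Sum>s\<le>n-i. pochhammer (a + of_nat i) (n - i - s) / fact (n - i - s) * (pochhammer b s / fact s)))"
    by (subst sum_triangle_swap) (simp add: sum_distrib_left)
  also have "\<dots> = (\<Sum>i\<le>n. pochhammer a i / fact i * u ^ i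
                    * (pochhammer (a + b + of_nat i) (n - i) / fact (n - i) * v ^ (n - i)))"
    by (simp only: pochhammer_vandermonde) (simp add: ac_simps)
  finally show ?thesis .
qed

section \<open>Even Gegenbauer polynomials as polynomials in the square\<close>

definition even_gegenbauer :: "nat \<Rightarrow> complex \<Rightarrow> complex \<Rightarrow> complex" where
  "even_gegenbauer k l y =
     (\<Sum>m\<le>k. pochhammer l (k + m) * pochhammer (1/2) k
               / (pochhammer (1/2) m * fact m * fact (k - m)) * (-1) ^ (k - m) * y ^ m)"

lemma pochhammer_half_nonzero [simp]: "pochhammer (1/2 :: complex) m \<noteq> 0"
  using fact_double[of m, where ?'a = complex] by auto

lemma gegenbauer_even:
  "fact (2 * k) * gegenbauer (2 * k) l x / (2 ^ (2 * k) * fact k) = even_gegenbauer k l (x ^ 2)"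
proof -
  have 1: "fact (2 * n) = 2 ^ (2 * n) * pochhammer (1/2 :: complex) n * fact n" for n
    by (rule fact_double)
  have pow: "(2 * x) ^ (2 * m) = 2 ^ (2 * m) * (x ^ 2) ^ m" for m
    by (simp add: power_mult_distrib power_mult)
  have "fact (2 * k) * gegenbauer (2 * k) l x / (2 ^ (2 * k) * fact k)
      = pochhammer (1/2) k * gegenbauer (2 * k) l x"
    by (simp add: 1)
  also have "\<dots> = (\<Sum>j\<le>k. pochhammer (1/2) k * ((-1) ^ j * pochhammer l (2 * k - j)
                  / (fact j * fact (2 * k - 2 * j)) * (2 * x) ^ (2 * k - 2 * j)))"
    by (simp add: gegenbauer_def sum_distrib_left)
  \<comment> \<open>The powers of \<open>x\<close> descend in \<open>j\<close>; \<open>m = k - j\<close> counts them upwards.\<close>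
  also have "\<dots> = (\<Sum>m\<le>k. pochhammer (1/2) k * ((-1) ^ (k - m) * pochhammer l (k + m)
                  / (fact (k - m) * fact (2 * m)) * (2 * x) ^ (2 * m)))"
  proof (rule sum.reindex_bij_witness[where i = "\<lambda>m. k - m" and j = "\<lambda>j. k - j"])
    fix j assume "j \<in> {..k}"
    hence "k + (k - j) = 2 * k - j" "2 * (k - j) = 2 * k - 2 * j" "k - (k - j) = j" by auto
    thus "pochhammer (1/2) k * ((-1) ^ (k - (k - j)) * pochhammer l (k + (k - j))
            / (fact (k - (k - j)) * fact (2 * (k - j))) * (2 * x) ^ (2 * (k - j)))
        = pochhammer (1/2) k * ((-1) ^ j * pochhammer l (2 * k - j)
            / (fact j * fact (2 * k - 2 * j)) * (2 * x) ^ (2 * k - 2 * j))"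
      by (simp only:)
  qed auto
  also have "\<dots> = even_gegenbauer k l (x ^ 2)"
    unfolding even_gegenbauer_def
    by (intro sum.cong refl, simp only: 1 pow) (simp add: mult_ac)
  finally show ?thesis .
qed

section \<open>The reciprocal sum\<close>

lemma even_gegenbauer_reciprocal:
  fixes y l :: complex
  assumes "y \<noteq> 0"
  shows "even_gegenbauer k l y
    = (\<Sum>r\<le>k. pochhammer (1/2 - 2 * of_nat k - l) (k - r) * pochhammer l (k - r) / fact (k - r)
         * (1 - y) ^ (k - r) * (y ^ r * even_gegenbauer r (l + of_nat k - of_nat r) (1 / y)))"
proof -
  define a where "a = 1/2 - 2 * of_nat k - l"
  have "(\<Sum>r\<le>k. pochhammer a (k - r) * pochhammer l (k - r) / fact (k - r)
         * (1 - y) ^ (k - r) * (y ^ r * even_gegenbauer r (l + of_nat k - of_nat r) (1 / y)))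
     = (\<Sum>r\<le>k. \<Sum>m\<le>r. pochhammer l (k + m) / fact m *
          (pochhammer a (k - r) / fact (k - r) * (1 - y) ^ (k - r)
            * (pochhammer (of_nat m + 1/2) (r - m) / fact (r - m) * (- y) ^ (r - m))))"
  proof (intro sum.cong refl)
    fix r assume "r \<in> {..k}"
    hence r: "r \<le> k" by simp
    \<comment> \<open>The shifted parameter lets \<open>(\<lambda>)\<^sub>k\<^sub>-\<^sub>r\<close> and the symbol in \<open>G\<^sub>r\<close> merge into one
        that is free of \<open>r\<close>.\<close>
    have *: "pochhammer l (k - r) * y ^ r * (pochhammer (l + of_nat k - of_nat r) (r + m)
             * pochhammer (1/2) r / (pochhammer (1/2) m * fact m * fact (r - m))
             * (-1) ^ (r - m) * (1 / y) ^ m)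
        = pochhammer l (k + m) / fact m
           * (pochhammer (of_nat m + 1/2) (r - m) / fact (r - m) * (- y) ^ (r - m))"
      if m: "m \<le> r" for m
    proof -
      have "pochhammer l (k + m)
          = pochhammer l (k - r) * pochhammer (l + of_nat (k - r)) (k + m - (k - r))"
        by (rule pochhammer_product) simp
      hence 1: "pochhammer l (k + m)
          = pochhammer l (k - r) * pochhammer (l + of_nat k - of_nat r) (r + m)"
        using r by (simp add: of_nat_diff algebra_simps)
      have 2: "pochhammer (1/2 :: complex) r
          = pochhammer (1/2) m * pochhammer (of_nat m + 1/2) (r - m)"
        using pochhammer_product[OF m, of "1/2 :: complex"] by (simp add: add.commute)
      have 3: "y ^ r = y ^ (r - m) * y ^ m"
        using m by (simp flip: power_add)
      show ?thesis
        unfolding 1 2 3 power_minus[of y "r - m"] using assms by (simp add: power_one_over)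
    qed
    show "pochhammer a (k - r) * pochhammer l (k - r) / fact (k - r)
         * (1 - y) ^ (k - r) * (y ^ r * even_gegenbauer r (l + of_nat k - of_nat r) (1 / y))
      = (\<Sum>m\<le>r. pochhammer l (k + m) / fact m *
          (pochhammer a (k - r) / fact (k - r) * (1 - y) ^ (k - r)
            * (pochhammer (of_nat m + 1/2) (r - m) / fact (r - m) * (- y) ^ (r - m))))"
      (is "?L = ?R")
    proof -
      have "?L = (\<Sum>m\<le>r. pochhammer a (k - r) / fact (k - r) * (1 - y) ^ (k - r) *
         (pochhammer l (k - r) * y ^ r * (pochhammer (l + of_nat k - of_nat r) (r + m)
             * pochhammer (1/2) r / (pochhammer (1/2) m * fact m * fact (r - m))
             * (-1) ^ (r - m) * (1 / y) ^ m)))"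
        unfolding even_gegenbauer_def sum_distrib_left by (intro sum.cong refl) simp
      also have "\<dots> = ?R"
        by (intro sum.cong refl, subst *) (simp_all add: mult_ac)
      finally show ?thesis .
    qed
  qed
  also have "\<dots> = (\<Sum>m\<le>k. pochhammer l (k + m) / fact m *
      (\<Sum>s\<le>k-m. pochhammer a (k - m - s) / fact (k - m - s) * (1 + - y) ^ (k - m - s)
            * (pochhammer (of_nat m + 1/2) s / fact s * (- y) ^ s)))"
    by (subst sum_triangle_reindex_diff) (simp add: sum_distrib_left)
  also have "\<dots> = (\<Sum>m\<le>k. \<Sum>i\<le>k-m. pochhammer l (k + m) / fact m *
      (pochhammer a i / fact i * (pochhammer (a + (of_nat m + 1/2) + of_nat i) (k - m - i)
          / fact (k - m - i) * (- y) ^ (k - m - i))))"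
    by (subst pochhammer_convolution_rebase) (simp add: sum_distrib_left)
  also have "\<dots> = (\<Sum>m\<le>k. \<Sum>p\<le>k-m. pochhammer l (k + m) / fact m *
      (pochhammer a (k - p - m) / fact (k - p - m)) * (pochhammer (l + of_nat k) p / fact p * y ^ p))"
  proof (rule sum.cong[OF refl])
    fix m assume "m \<in> {..k}"
    hence m: "m \<le> k" by simp
    \<comment> \<open>On the diagonal \<open>m + i = k - p\<close> the base is \<open>1 - (l + k + p)\<close>, independent of \<open>m\<close>;
        reversing the product cancels the sign of \<open>(-y)\<^sup>p\<close>.\<close>
    have *: "pochhammer (a + (of_nat m + 1/2) + of_nat (k - p - m)) p * (- y) ^ p
        = pochhammer (l + of_nat k) p * y ^ p" if "p \<le> k - m" for p
    proof -
      have "a + (of_nat m + 1/2) + of_nat (k - p - m) = - (l + of_nat k + of_nat p - 1)"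
        using that m by (simp add: a_def of_nat_diff algebra_simps)
      moreover have "pochhammer (- (l + of_nat k + of_nat p - 1)) p
          = (-1) ^ p * pochhammer (l + of_nat k) p"
        by (subst pochhammer_minus) (simp add: algebra_simps)
      ultimately show ?thesis
        by (simp add: power_minus[of y p])
    qed
    show "(\<Sum>i\<le>k-m. pochhammer l (k + m) / fact m *
      (pochhammer a i / fact i * (pochhammer (a + (of_nat m + 1/2) + of_nat i) (k - m - i)
          / fact (k - m - i) * (- y) ^ (k - m - i))))
     = (\<Sum>p\<le>k-m. pochhammer l (k + m) / fact m *
      (pochhammer a (k - p - m) / fact (k - p - m)) * (pochhammer (l + of_nat k) p / fact p * y ^ p))"
    proof (rule sum.reindex_bij_witness[where i = "\<lambda>p. k - m - p" and j = "\<lambda>i. k - m - i"])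
      fix i assume "i \<in> {..k-m}"
      hence "k - m - i \<le> k - m" "k - (k - m - i) - m = i" using m by auto
      thus "pochhammer l (k + m) / fact m *
      (pochhammer a (k - (k - m - i) - m) / fact (k - (k - m - i) - m)) *
          (pochhammer (l + of_nat k) (k - m - i) / fact (k - m - i) * y ^ (k - m - i))
       = pochhammer l (k + m) / fact m *
      (pochhammer a i / fact i * (pochhammer (a + (of_nat m + 1/2) + of_nat i) (k - m - i)
          / fact (k - m - i) * (- y) ^ (k - m - i)))"
        using *[of "k - m - i"] by (simp add: mult_ac)
    qed auto
  qed
  also have "\<dots> = (\<Sum>p\<le>k. pochhammer l k * (pochhammer (l + of_nat k) p / fact p * y ^ p) *
      (\<Sum>m\<le>k-p. pochhammer a (k - p - m) / fact (k - p - m)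
          * (pochhammer (l + of_nat k) m / fact m)))"
    by (subst sum_triangle_swap) (simp add: sum_distrib_left pochhammer_product' mult_ac)
  also have "\<dots> = even_gegenbauer k l y"
    unfolding even_gegenbauer_def
  proof (intro sum.cong refl)
    fix p assume "p \<in> {..k}"
    hence p: "p \<le> k" by simp
    \<comment> \<open>Chu-Vandermonde gives the base \<open>a + l + k = 1/2 - k\<close>; reversing that product produces
        the sign and the quotient \<open>(1/2)\<^sub>k / (1/2)\<^sub>p\<close> of \<open>G\<^sub>k\<close>.\<close>
    have "a + (l + of_nat k) = - (1/2 + of_nat p + of_nat (k - p) - 1)"
      using p by (simp add: a_def of_nat_diff algebra_simps)
    hence "pochhammer (a + (l + of_nat k)) (k - p)
        = (-1) ^ (k - p) * pochhammer (1/2 + of_nat p) (k - p)"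
      by (simp only: pochhammer_minus) (simp add: algebra_simps)
    also have "pochhammer (1/2 + of_nat p :: complex) (k - p) = pochhammer (1/2) k / pochhammer (1/2) p"
      using pochhammer_product[OF p, of "1/2 :: complex"] by simp
    finally have "pochhammer (a + (l + of_nat k)) (k - p)
        = (-1) ^ (k - p) * (pochhammer (1/2) k / pochhammer (1/2) p)" .
    thus "pochhammer l k * (pochhammer (l + of_nat k) p / fact p * y ^ p) *
      (\<Sum>m\<le>k-p. pochhammer a (k - p - m) / fact (k - p - m)
          * (pochhammer (l + of_nat k) m / fact m))
      = pochhammer l (k + p) * pochhammer (1/2) k
               / (pochhammer (1/2) p * fact p * fact (k - p)) * (-1) ^ (k - p) * y ^ p"
      by (simp only: pochhammer_vandermonde pochhammer_product') (simp add: mult_ac)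
  qed
  finally show ?thesis by (simp add: a_def)
qed

lemma gegenbauer_reciprocal_sum:
  fixes x :: complex
  assumes "x \<noteq> 0" "x ^ 2 \<noteq> 1"
  shows "fact (2 * k) * gegenbauer (2 * k) (\<mu> + 1/2) x / (2 ^ (2 * k) * fact k * (1 - x ^ 2) ^ k)
       = (\<Sum>r\<le>k. sum_coeff \<mu> k r *
            (fact (2 * r) * gegenbauer (2 * r) (\<mu> + of_nat k - of_nat r + 1/2) (1 / x)
              / (2 ^ (2 * r) * fact r * (1 / x ^ 2 - 1) ^ r)))"
proof -
  define y where "y = x ^ 2"
  have y: "y \<noteq> 0" "1 - y \<noteq> 0" using assms by (auto simp: y_def)
  have quot: "fact (2 * n) * gegenbauer (2 * n) l z / (2 ^ (2 * n) * fact n * d)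
      = even_gegenbauer n l (z ^ 2) / d" for n l z d
    by (simp flip: gegenbauer_even)
  have "even_gegenbauer k (\<mu> + 1/2) y / (1 - y) ^ k
     = (\<Sum>r\<le>k. pochhammer (1/2 - 2 * of_nat k - (\<mu> + 1/2)) (k - r) * pochhammer (\<mu> + 1/2) (k - r)
         / fact (k - r) * (1 - y) ^ (k - r)
         * (y ^ r * even_gegenbauer r (\<mu> + 1/2 + of_nat k - of_nat r) (1 / y)) / (1 - y) ^ k)"
    by (simp add: even_gegenbauer_reciprocal[OF y(1), of k "\<mu> + 1/2"] sum_divide_distrib)
  also have "\<dots> = (\<Sum>r\<le>k. sum_coeff \<mu> k r *
            (even_gegenbauer r (\<mu> + of_nat k - of_nat r + 1/2) (1 / y) / (1 / y - 1) ^ r))"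
  proof (intro sum.cong refl)
    fix r assume "r \<in> {..k}"
    hence "(1 - y) ^ k = (1 - y) ^ (k - r) * (1 - y) ^ r" by (simp flip: power_add)
    moreover have "(1 / y - 1) ^ r = (1 - y) ^ r / y ^ r"
      using y by (simp add: diff_divide_distrib flip: power_divide)
    moreover have "1/2 - 2 * of_nat k - (\<mu> + 1/2) = - 2 * of_nat k - \<mu>"
      "\<mu> + 1/2 + of_nat k - of_nat r = \<mu> + of_nat k - of_nat r + 1/2" by simp_all
    ultimately show "pochhammer (1/2 - 2 * of_nat k - (\<mu> + 1/2)) (k - r) * pochhammer (\<mu> + 1/2) (k - r)
         / fact (k - r) * (1 - y) ^ (k - r)
         * (y ^ r * even_gegenbauer r (\<mu> + 1/2 + of_nat k - of_nat r) (1 / y)) / (1 - y) ^ k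
       = sum_coeff \<mu> k r *
            (even_gegenbauer r (\<mu> + of_nat k - of_nat r + 1/2) (1 / y) / (1 / y - 1) ^ r)"
      using y unfolding sum_coeff_def by (simp only:) (simp add: mult_ac)
  qed
  finally show ?thesis
    unfolding quot by (simp add: y_def power_one_over)
qed

section \<open>The inverse pair of sums\<close>

text \<open>In each of the two Pochhammer symbols the second factor starts where the first one stops:
  \<open>-2k - \<mu> + (k - r)\<close> equals \<open>-2r - (\<mu> + k - r)\<close>, and \<open>\<mu> + 1/2 + (k - r)\<close> is the shifted
  parameter. Only the factorials see \<open>r\<close>.\<close>

lemma sum_coeff_compose:
  assumes "s \<le> r" "r \<le> k"
  shows "sum_coeff \<mu> k r * sum_coeff (\<mu> + of_nat k - of_nat r) r s
       = sum_coeff \<mu> k s * of_nat (k - s choose (r - s))"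
proof -
  have le: "k - r \<le> k - s" and diff: "k - s - (k - r) = r - s" "k - s - (r - s) = k - r"
    using assms by auto
  have shift: "- 2 * of_nat k - \<mu> + of_nat (k - r) = - 2 * of_nat r - (\<mu> + of_nat k - of_nat r)"
    using assms by (simp add: of_nat_diff algebra_simps)
  have "pochhammer (- 2 * of_nat k - \<mu>) (k - s) = pochhammer (- 2 * of_nat k - \<mu>) (k - r)
      * pochhammer (- 2 * of_nat r - (\<mu> + of_nat k - of_nat r)) (r - s)"
    using pochhammer_product[OF le, of "- 2 * of_nat k - \<mu>"] unfolding diff shift .
  moreover have "pochhammer (\<mu> + 1/2) (k - s)
      = pochhammer (\<mu> + 1/2) (k - r) * pochhammer (\<mu> + of_nat k - of_nat r + 1/2) (r - s)"
    using pochhammer_product[OF le, of "\<mu> + 1/2"] assms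
    by (simp add: diff of_nat_diff algebra_simps)
  moreover have "of_nat (k - s choose (r - s)) = (fact (k - s) / (fact (r - s) * fact (k - r)) :: complex)"
    using assms by (subst binomial_fact) (auto simp: diff)
  ultimately show ?thesis
    unfolding sum_coeff_def by (simp only:) (simp add: mult_ac)
qed

lemma alternating_binomial_sum:
  assumes "s \<le> k"
  shows "(\<Sum>r=s..k. (-1) ^ (r + s) * of_nat (k - s choose (r - s)))
       = (if s = k then 1 else 0 :: complex)"
proof -
  have "(\<Sum>r=s..k. (-1) ^ (r + s) * of_nat (k - s choose (r - s)) :: complex)
      = (\<Sum>i\<le>k-s. (-1) ^ i * of_nat (k - s choose i))"
    using assms
    by (intro sum.reindex_bij_witness[where i = "\<lambda>i. i + s" and j = "\<lambda>r. r - s"])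
       (auto simp: minus_one_power_iff)
  also have "\<dots> = (if s = k then 1 else 0)"
    using assms choose_alternating_sum[of "k - s", where ?'a = complex] by auto
  finally show ?thesis .
qed

text \<open>The shifts add up: passing from \<open>k\<close> to \<open>r\<close> and from \<open>r\<close> to \<open>s\<close> moves \<open>\<mu>\<close> to
  \<open>\<mu> + k - s\<close>, whatever \<open>r\<close> is. The transformations therefore compose like triangular
  matrices.\<close>

lemma shifted_transform_left_inverse:
  fixes c d :: "complex \<Rightarrow> nat \<Rightarrow> nat \<Rightarrow> complex"
  assumes inv: "\<And>\<mu> k s. s \<le> k \<Longrightarrow>
      (\<Sum>r=s..k. d \<mu> k r * c (\<mu> + of_nat k - of_nat r) r s) = (if s = k then 1 else 0)"
    and a: "\<And>\<mu> k. a \<mu> k = (\<Sum>r\<le>k. c \<mu> k r * b (\<mu> + of_nat k - of_nat r) r)"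
  shows "b \<mu> k = (\<Sum>r\<le>k. d \<mu> k r * a (\<mu> + of_nat k - of_nat r) r)"
proof -
  have "(\<Sum>r\<le>k. d \<mu> k r * a (\<mu> + of_nat k - of_nat r) r)
     = (\<Sum>r\<le>k. \<Sum>s\<le>r. d \<mu> k r * c (\<mu> + of_nat k - of_nat r) r s * b (\<mu> + of_nat k - of_nat s) s)"
    by (simp add: a sum_distrib_left mult.assoc)
  also have "\<dots> = (\<Sum>s\<le>k. \<Sum>r=s..k. d \<mu> k r * c (\<mu> + of_nat k - of_nat r) r s
                      * b (\<mu> + of_nat k - of_nat s) s)"
    unfolding sum.Sigma[OF finite_atMost, OF ballI, OF finite_atMost]
      sum.Sigma[OF finite_atMost, OF ballI, OF finite_atLeastAtMost]
    by (rule sum.reindex_bij_witness[where i = "\<lambda>(s, r). (r, s)" and j = "\<lambda>(r, s). (s, r)"]) auto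
  also have "\<dots> = (\<Sum>s\<le>k. (if s = k then 1 else 0) * b (\<mu> + of_nat k - of_nat s) s)"
    by (intro sum.cong refl) (simp add: inv flip: sum_distrib_right)
  also have "\<dots> = (\<Sum>s\<le>k. if s = k then b \<mu> k else 0)"
    by (intro sum.cong refl) auto
  also have "\<dots> = b \<mu> k"
    by simp
  finally show ?thesis by simp
qed

lemma inverse_sums_sum_coeff:
  "inverse_sums sum_coeff (\<lambda>\<nu> n r. (-1) ^ (n + r) * sum_coeff \<nu> n r)"
proof -
  have cc: "(\<Sum>r=s..k. e r * (sum_coeff \<mu> k r * sum_coeff (\<mu> + of_nat k - of_nat r) r s))
      = sum_coeff \<mu> k s * (\<Sum>r=s..k. e r * of_nat (k - s choose (r - s)))" for \<mu> k s e
    unfolding sum_distrib_left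
    by (intro sum.cong refl) (simp add: sum_coeff_compose mult_ac)
  have self: "sum_coeff \<mu> k k = 1" for \<mu> k by (simp add: sum_coeff_def)
  \<comment> \<open>The two orders of composition differ only by the sign \<open>(-1)\<^sup>k\<^sup>+\<^sup>s\<close>, which is \<open>1\<close> on the diagonal.\<close>
  have right: "(\<Sum>r=s..k. sum_coeff \<mu> k r * ((-1) ^ (r + s) * sum_coeff (\<mu> + of_nat k - of_nat r) r s))
      = (if s = k then 1 else 0)" if "s \<le> k" for \<mu> k s
    using cc[where e = "\<lambda>r. (-1) ^ (r + s)", of \<mu> k s] alternating_binomial_sum[OF that]
    by (auto simp: mult_ac self)
  have left: "(\<Sum>r=s..k. (-1) ^ (k + r) * sum_coeff \<mu> k r * sum_coeff (\<mu> + of_nat k - of_nat r) r s)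
      = (if s = k then 1 else 0)" if "s \<le> k" for \<mu> k s
  proof -
    have "(\<Sum>r=s..k. (-1) ^ (k + r) * sum_coeff \<mu> k r * sum_coeff (\<mu> + of_nat k - of_nat r) r s)
       = (-1) ^ (k + s) * (\<Sum>r=s..k. sum_coeff \<mu> k r
            * ((-1) ^ (r + s) * sum_coeff (\<mu> + of_nat k - of_nat r) r s))"
      unfolding sum_distrib_left by (intro sum.cong refl) (auto simp: minus_one_power_iff)
    thus ?thesis using that by (simp add: right)
  qed
  show ?thesis
    unfolding inverse_sums_def
    by (intro allI iffI; rule shifted_transform_left_inverse) (use left right in auto)
qed

section \<open>The Gegenbauer sums and their inversion\<close>

theorem corollary6:
  fixes \<mu> :: complex and k :: nat and x :: real
  assumes "x \<noteq> 0" and "x \<noteq> 1" and "x \<noteq> -1"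
  shows
    "fact (2 * k) * gegenbauer (2 * k) (\<mu> + 1/2) (of_real x)
         / (2 ^ (2 * k) * fact k * of_real (1 - x ^ 2) ^ k)
       = (\<Sum>r\<le>k. sum_coeff \<mu> k r *
            (fact (2 * r) * gegenbauer (2 * r) (\<mu> + of_nat k - of_nat r + 1/2) (of_real (1 / x))
              / (2 ^ (2 * r) * fact r * of_real (1 / x ^ 2 - 1) ^ r)))
     \<and> fact (2 * k) * gegenbauer (2 * k) (\<mu> + 1/2) (of_real (1 / x))
         / (2 ^ (2 * k) * fact k * of_real (1 - 1 / x ^ 2) ^ k)
       = (\<Sum>r\<le>k. sum_coeff \<mu> k r *
            (fact (2 * r) * gegenbauer (2 * r) (\<mu> + of_nat k - of_nat r + 1/2) (of_real x)
              / (2 ^ (2 * r) * fact r * of_real (x ^ 2 - 1) ^ r)))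
     \<and> inverse_sums sum_coeff (\<lambda>\<nu> n r. (-1) ^ (n + r) * sum_coeff \<nu> n r)"
proof (intro conjI)
  have "x ^ 2 \<noteq> 1"
    using assms by (simp add: power2_eq_1_iff)
  hence sq: "complex_of_real x ^ 2 \<noteq> 1" "(1 / complex_of_real x) ^ 2 \<noteq> 1"
    by (auto simp: power_one_over simp flip: of_real_power)
  have nz: "complex_of_real x \<noteq> 0" "1 / complex_of_real x \<noteq> 0"
    using assms by auto
  show "fact (2 * k) * gegenbauer (2 * k) (\<mu> + 1/2) (of_real x)
         / (2 ^ (2 * k) * fact k * of_real (1 - x ^ 2) ^ k)
       = (\<Sum>r\<le>k. sum_coeff \<mu> k r *
            (fact (2 * r) * gegenbauer (2 * r) (\<mu> + of_nat k - of_nat r + 1/2) (of_real (1 / x))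
              / (2 ^ (2 * r) * fact r * of_real (1 / x ^ 2 - 1) ^ r)))"
    using gegenbauer_reciprocal_sum[OF nz(1) sq(1), of k \<mu>] by simp
  show "fact (2 * k) * gegenbauer (2 * k) (\<mu> + 1/2) (of_real (1 / x))
         / (2 ^ (2 * k) * fact k * of_real (1 - 1 / x ^ 2) ^ k)
       = (\<Sum>r\<le>k. sum_coeff \<mu> k r *
            (fact (2 * r) * gegenbauer (2 * r) (\<mu> + of_nat k - of_nat r + 1/2) (of_real x)
              / (2 ^ (2 * r) * fact r * of_real (x ^ 2 - 1) ^ r)))"
    using gegenbauer_reciprocal_sum[OF nz(2) sq(2), of k \<mu>] by (simp add: power_one_over)
qed (rule inverse_sums_sum_coeff)

end
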